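(* If a formula $F$ is forced at every node $k$ in every constrained Kripke structure $K$, then $F$ is derivable in $LJ^+$.
   Context: Formulas are first-order formulas of a language $L$ without function symbols and without object constants, built from propositional symbols (relation symbols of arity $0$), predicate symbols (relation symbols of arity at least $1$), the logical constants $\top,\bot$, the connectives $\&,\lor,\neg,\supset$ and the quantifiers $\forall,\exists$; quantified formulas $\forall x\,F(x)$, $\exists x\,F(x)$ are formed only from $F(x)$ in which $x$ occurs free. $\top,\bot$ are not counted as propositional or predicate symbols. A formula is propositional if it contains only propositional symbols (no predicate symbols). A sequent is $\Gamma\vdash\Lambda$ with $\Gamma$ a finite, possibly empty sequence of formulas and $\Lambda$ either a single formula or empty. The calculus $LJ$ (Gentzen's intuitionistic sequent calculus) has axioms $A\vdash A$ (any formula $A$), $\vdash\top$, $\bot\vdash$, and the following rules (premises / conclusion). Thinning: $\Gamma\vdash\Lambda\,/\,A,\Gamma\vdash\Lambda$; $\Gamma\vdash\,/\,\Gamma\vdash A$. Contraction: $A,A,\Gamma\vdash\Lambda\,/\,A,\Gamma\vdash\Lambda$. Exchange: $\Pi,A,B,\Gamma\vdash\Lambda\,/\,\Pi,B,A,\Gamma\vdash\Lambda$. Cut: $\Gamma\vdash C$ and $C,\Pi\vdash\Lambda\,/\,\Gamma,\Pi\vdash\Lambda$. $\&$: $\Gamma\vdash A$ and $\Gamma\vdash B\,/\,\Gamma\vdash A\&B$; $A,\Gamma\vdash\Lambda\,/\,A\&B,\Gamma\vdash\Lambda$; $B,\Gamma\vdash\Lambda\,/\,A\&B,\Gamma\vdash\Lambda$.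 $\lor$: $A,\Gamma\vdash\Lambda$ and $B,\Gamma\vdash\Lambda\,/\,A\lor B,\Gamma\vdash\Lambda$; $\Gamma\vdash A\,/\,\Gamma\vdash A\lor B$; $\Gamma\vdash B\,/\,\Gamma\vdash A\lor B$. $\neg$: $A,\Gamma\vdash\,/\,\Gamma\vdash\neg A$; $\Gamma\vdash A\,/\,\neg A,\Gamma\vdash$. $\supset$: $A,\Gamma\vdash B\,/\,\Gamma\vdash A\supset B$; $\Gamma\vdash A$ and $B,\Pi\vdash\Lambda\,/\,A\supset B,\Gamma,\Pi\vdash\Lambda$. $\forall$: $\Gamma\vdash F(a)\,/\,\Gamma\vdash\forall x\,F(x)$; $F(a),\Gamma\vdash\Lambda\,/\,\forall x\,F(x),\Gamma\vdash\Lambda$. $\exists$: $\Gamma\vdash F(a)\,/\,\Gamma\vdash\exists x\,F(x)$; $F(a),\Gamma\vdash\Lambda\,/\,\exists x\,F(x),\Gamma\vdash\Lambda$. Here $a$ is a variable and $F(a)$ is the result of (capture-free) substitution of $a$ for $x$ in $F(x)$; in the $\forall$-succedent and $\exists$-antecedent rules $a$ (the eigenvariable) must not occur in the conclusion. $LJ^+$ is $LJ$ extended with the neutralization rule: $N,\Gamma\vdash\Lambda$ and $\neg N,\Gamma\vdash\Lambda\,/\,\Gamma\vdash\Lambda$, where $N$ must be a propositional formula. A formula $A$ is derivable if the sequent $\vdash A$ is. A Kripke structure $K$ consists of a partially ordered set (also denoted $K$) of nodes, a function $D$ assigning to each node $k$ a nonempty domain $D(k)$ with $D(k)\subseteq D(k')$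 whenever $k\le k'$, and a valuation $T$ assigning to each node $k$ a set $T(k)$ of atomic expressions of $L$ over $D(k)$ (expressions $P(d_1,\dots,d_n)$, $n\ge 0$, $d_i\in D(k)$) with $T(k)\subseteq T(k')$ whenever $k\le k'$. Forcing: $k$ forces an atomic expression $P(d_1,\dots,d_n)$ iff it is in $T(k)$; $k$ forces $A\&B$ iff $k$ forces $A$ and $k$ forces $B$; $k$ forces $A\lor B$ iff $k$ forces $A$ or $k$ forces $B$; $k$ forces $A\supset B$ iff for every $k'\ge k$, if $k'$ forces $A$ then $k'$ forces $B$; $k$ forces $\neg A$ iff no $k'\ge k$ forces $A$; $k$ forces $\forall x\,A(x)$ iff for every $k'\ge k$ and every $d\in D(k')$, $k'$ forces $A(d)$; $k$ forces $\exists x\,A(x)$ iff for some $d\in D(k)$, $k$ forces $A(d)$; $\top$ is forced by every node and $\bot$ by none. A formula with free variables is forced at $k$ if it is forced at $k$ under every assignment of elements of $D(k)$ to its free variables. A Kripke structure is constrained if for all $k\le k'$ and every propositional symbol $Q$, either both $T(k)$ and $T(k')$ contain $Q$ or neither does. *)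

theory Defs
  imports Main
begin

section \<open>Formulas\<close>

text \<open>
  A language without function symbols and object constants is a partial map assigning their
  arities to its relation symbols; the propositional symbols are those of arity 0.
\<close>

type_synonym 'p lang = "'p \<Rightarrow> nat option"

type_synonym var = nat

datatype 'p fm =
    Top
  | Bot
  | Rel 'p "var list"
  | And "'p fm" "'p fm"
  | Or "'p fm" "'p fm"
  | Neg "'p fm"
  | Imp "'p fm" "'p fm"
  | All var "'p fm"
  | Ex var "'p fm"

primrec fv :: "'p fm \<Rightarrow> var set" where
  "fv Top = {}"
| "fv Bot = {}"
| "fv (Rel p xs) = set xs"
| "fv (And A B) = fv A \<union> fv B"
| "fv (Or A B) = fv A \<union> fv B"
| "fv (Neg A) = fv A"
| "fv (Imp A B) = fv A \<union> fv B"
| "fv (All x A) = fv A - {x}"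
| "fv (Ex x A) = fv A - {x}"

text \<open>All variables occurring in a formula, free or bound.\<close>

primrec vars :: "'p fm \<Rightarrow> var set" where
  "vars Top = {}"
| "vars Bot = {}"
| "vars (Rel p xs) = set xs"
| "vars (And A B) = vars A \<union> vars B"
| "vars (Or A B) = vars A \<union> vars B"
| "vars (Neg A) = vars A"
| "vars (Imp A B) = vars A \<union> vars B"
| "vars (All x A) = insert x (vars A)"
| "vars (Ex x A) = insert x (vars A)"

primrec syms :: "'p fm \<Rightarrow> 'p set" where
  "syms Top = {}"
| "syms Bot = {}"
| "syms (Rel p xs) = {p}"
| "syms (And A B) = syms A \<union> syms B"
| "syms (Or A B) = syms A \<union> syms B"
| "syms (Neg A) = syms A"
| "syms (Imp A B) = syms A \<union> syms B"
| "syms (All x A) = syms A"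
| "syms (Ex x A) = syms A"

text \<open>
  The formulas of a language. Arities are respected, and a quantifier may only bind a variable
  that occurs free in its scope.
\<close>

primrec formula :: "'p lang \<Rightarrow> 'p fm \<Rightarrow> bool" where
  "formula L Top \<longleftrightarrow> True"
| "formula L Bot \<longleftrightarrow> True"
| "formula L (Rel p xs) \<longleftrightarrow> L p = Some (length xs)"
| "formula L (And A B) \<longleftrightarrow> formula L A \<and> formula L B"
| "formula L (Or A B) \<longleftrightarrow> formula L A \<and> formula L B"
| "formula L (Neg A) \<longleftrightarrow> formula L A"
| "formula L (Imp A B) \<longleftrightarrow> formula L A \<and> formula L B"
| "formula L (All x A) \<longleftrightarrow> formula L A \<and> x \<in> fv A"
| "formula L (Ex x A) \<longleftrightarrow> formula L A \<and> x \<in> fv A"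

definition propositional :: "'p lang \<Rightarrow> 'p fm \<Rightarrow> bool" where
  "propositional L A \<longleftrightarrow> formula L A \<and> (\<forall>p\<in>syms A. L p = Some 0)"

text \<open>
  \<open>subst x a A\<close> replaces the free occurrences of \<open>x\<close> in \<open>A\<close> by \<open>a\<close> without renaming bound
  variables. It is used only when \<open>free_for a x A\<close> holds, that is, when no replaced
  occurrence of \<open>x\<close> lies in the scope of a quantifier binding \<open>a\<close>.
\<close>

primrec subst :: "var \<Rightarrow> var \<Rightarrow> 'p fm \<Rightarrow> 'p fm" where
  "subst x a Top = Top"
| "subst x a Bot = Bot"
| "subst x a (Rel p ys) = Rel p (map (\<lambda>y. if y = x then a else y) ys)"
| "subst x a (And A B) = And (subst x a A) (subst x a B)"
| "subst x a (Or A B) = Or (subst x a A) (subst x a B)"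
| "subst x a (Neg A) = Neg (subst x a A)"
| "subst x a (Imp A B) = Imp (subst x a A) (subst x a B)"
| "subst x a (All y A) = (if y = x then All y A else All y (subst x a A))"
| "subst x a (Ex y A) = (if y = x then Ex y A else Ex y (subst x a A))"

primrec free_for :: "var \<Rightarrow> var \<Rightarrow> 'p fm \<Rightarrow> bool" where
  "free_for a x Top \<longleftrightarrow> True"
| "free_for a x Bot \<longleftrightarrow> True"
| "free_for a x (Rel p ys) \<longleftrightarrow> True"
| "free_for a x (And A B) \<longleftrightarrow> free_for a x A \<and> free_for a x B"
| "free_for a x (Or A B) \<longleftrightarrow> free_for a x A \<and> free_for a x B"
| "free_for a x (Neg A) \<longleftrightarrow> free_for a x A"
| "free_for a x (Imp A B) \<longleftrightarrow> free_for a x A \<and> free_for a x B"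
| "free_for a x (All y A) \<longleftrightarrow> (x \<in> fv (All y A) \<longrightarrow> y \<noteq> a \<and> free_for a x A)"
| "free_for a x (Ex y A) \<longleftrightarrow> (x \<in> fv (Ex y A) \<longrightarrow> y \<noteq> a \<and> free_for a x A)"


section \<open>The calculus\<close>

text \<open>
  \<open>LJ_plus L \<Gamma> \<Lambda>\<close> means that the sequent with antecedent \<open>\<Gamma>\<close> and succedent \<open>\<Lambda>\<close> is derivable;
  \<open>None\<close> is the empty succedent. The last rule is neutralization, the others are those of
  Gentzen's LJ. The \<open>formula\<close> premises concern exactly the formulas that a rule introduces;
  as \<open>LJ_plus_formula\<close> below shows, they restrict derivations to sequents of \<open>L\<close>-formulas.
\<close>

inductive LJ_plus :: "'p lang \<Rightarrow> 'p fm list \<Rightarrow> 'p fm option \<Rightarrow> bool" for L where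
  Ax: "formula L A \<Longrightarrow> LJ_plus L [A] (Some A)"
| TopAx: "LJ_plus L [] (Some Top)"
| BotAx: "LJ_plus L [Bot] None"
| ThinL: "LJ_plus L \<Gamma> \<Lambda> \<Longrightarrow> formula L A \<Longrightarrow> LJ_plus L (A # \<Gamma>) \<Lambda>"
| ThinR: "LJ_plus L \<Gamma> None \<Longrightarrow> formula L A \<Longrightarrow> LJ_plus L \<Gamma> (Some A)"
| Contr: "LJ_plus L (A # A # \<Gamma>) \<Lambda> \<Longrightarrow> LJ_plus L (A # \<Gamma>) \<Lambda>"
| Exch: "LJ_plus L (\<Pi> @ A # B # \<Gamma>) \<Lambda> \<Longrightarrow> LJ_plus L (\<Pi> @ B # A # \<Gamma>) \<Lambda>"
| Cut: "LJ_plus L \<Gamma> (Some C) \<Longrightarrow> LJ_plus L (C # \<Pi>) \<Lambda> \<Longrightarrow> LJ_plus L (\<Gamma> @ \<Pi>) \<Lambda>"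
| AndR: "LJ_plus L \<Gamma> (Some A) \<Longrightarrow> LJ_plus L \<Gamma> (Some B) \<Longrightarrow> LJ_plus L \<Gamma> (Some (And A B))"
| AndL1: "LJ_plus L (A # \<Gamma>) \<Lambda> \<Longrightarrow> formula L B \<Longrightarrow> LJ_plus L (And A B # \<Gamma>) \<Lambda>"
| AndL2: "LJ_plus L (B # \<Gamma>) \<Lambda> \<Longrightarrow> formula L A \<Longrightarrow> LJ_plus L (And A B # \<Gamma>) \<Lambda>"
| OrL: "LJ_plus L (A # \<Gamma>) \<Lambda> \<Longrightarrow> LJ_plus L (B # \<Gamma>) \<Lambda> \<Longrightarrow> LJ_plus L (Or A B # \<Gamma>) \<Lambda>"
| OrR1: "LJ_plus L \<Gamma> (Some A) \<Longrightarrow> formula L B \<Longrightarrow> LJ_plus L \<Gamma> (Some (Or A B))"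
| OrR2: "LJ_plus L \<Gamma> (Some B) \<Longrightarrow> formula L A \<Longrightarrow> LJ_plus L \<Gamma> (Some (Or A B))"
| NegR: "LJ_plus L (A # \<Gamma>) None \<Longrightarrow> LJ_plus L \<Gamma> (Some (Neg A))"
| NegL: "LJ_plus L \<Gamma> (Some A) \<Longrightarrow> LJ_plus L (Neg A # \<Gamma>) None"
| ImpR: "LJ_plus L (A # \<Gamma>) (Some B) \<Longrightarrow> LJ_plus L \<Gamma> (Some (Imp A B))"
| ImpL: "LJ_plus L \<Gamma> (Some A) \<Longrightarrow> LJ_plus L (B # \<Pi>) \<Lambda> \<Longrightarrow>
    LJ_plus L (Imp A B # \<Gamma> @ \<Pi>) \<Lambda>"
| AllR: "LJ_plus L \<Gamma> (Some (subst x a F)) \<Longrightarrow> free_for a x F \<Longrightarrow> formula L (All x F) \<Longrightarrow>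
    a \<notin> vars (All x F) \<Longrightarrow> \<forall>G\<in>set \<Gamma>. a \<notin> vars G \<Longrightarrow>
    LJ_plus L \<Gamma> (Some (All x F))"
| AllL: "LJ_plus L (subst x a F # \<Gamma>) \<Lambda> \<Longrightarrow> free_for a x F \<Longrightarrow> formula L (All x F) \<Longrightarrow>
    LJ_plus L (All x F # \<Gamma>) \<Lambda>"
| ExR: "LJ_plus L \<Gamma> (Some (subst x a F)) \<Longrightarrow> free_for a x F \<Longrightarrow> formula L (Ex x F) \<Longrightarrow>
    LJ_plus L \<Gamma> (Some (Ex x F))"
| ExL: "LJ_plus L (subst x a F # \<Gamma>) \<Lambda> \<Longrightarrow> free_for a x F \<Longrightarrow> formula L (Ex x F) \<Longrightarrow>
    a \<notin> vars (Ex x F) \<Longrightarrow> \<forall>G\<in>set \<Gamma> \<union> set_option \<Lambda>. a \<notin> vars G \<Longrightarrow>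
    LJ_plus L (Ex x F # \<Gamma>) \<Lambda>"
| Neutral: "LJ_plus L (N # \<Gamma>) \<Lambda> \<Longrightarrow> LJ_plus L (Neg N # \<Gamma>) \<Lambda> \<Longrightarrow> propositional L N \<Longrightarrow>
    LJ_plus L \<Gamma> \<Lambda>"

lemma LJ_plus_formula:
  assumes "LJ_plus L \<Gamma> \<Lambda>"
  shows "\<forall>A \<in> set \<Gamma> \<union> set_option \<Lambda>. formula L A"
  using assms by induction auto

definition derivable :: "'p lang \<Rightarrow> 'p fm \<Rightarrow> bool" where
  "derivable L A \<longleftrightarrow> LJ_plus L [] (Some A)"


section \<open>Kripke structures\<close>

text \<open>
  An atomic expression \<open>P(d\<^sub>1,\<dots>,d\<^sub>n)\<close> over a domain is represented by the pair of \<open>P\<close> and the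
  list of its arguments.
\<close>

record ('p, 'k, 'd) kripke =
  nodes :: "'k set"
  order :: "('k \<times> 'k) set"
  domain :: "'k \<Rightarrow> 'd set"
  valuation :: "'k \<Rightarrow> ('p \<times> 'd list) set"

definition kripke_structure :: "'p lang \<Rightarrow> ('p, 'k, 'd) kripke \<Rightarrow> bool" where
  "kripke_structure L K \<longleftrightarrow>
    partial_order_on (nodes K) (order K) \<and>
    (\<forall>k \<in> nodes K. domain K k \<noteq> {}) \<and>
    (\<forall>k \<in> nodes K. valuation K k \<subseteq>
      {(p, ds). L p = Some (length ds) \<and> set ds \<subseteq> domain K k}) \<and>
    (\<forall>(k, k') \<in> order K. domain K k \<subseteq> domain K k' \<and> valuation K k \<subseteq> valuation K k')"

definition constrained :: "'p lang \<Rightarrow> ('p, 'k, 'd) kripke \<Rightarrow> bool" where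
  "constrained L K \<longleftrightarrow>
    (\<forall>(k, k') \<in> order K. \<forall>q. L q = Some 0 \<longrightarrow>
      ((q, []) \<in> valuation K k \<longleftrightarrow> (q, []) \<in> valuation K k'))"

text \<open>
  \<open>forces K k e A\<close>: the node \<open>k\<close> forces \<open>A\<close> with the elements \<open>e x\<close> in place of its free
  variables \<open>x\<close>.
\<close>

primrec forces :: "('p, 'k, 'd) kripke \<Rightarrow> 'k \<Rightarrow> (var \<Rightarrow> 'd) \<Rightarrow> 'p fm \<Rightarrow> bool" where
  "forces K k e Top \<longleftrightarrow> True"
| "forces K k e Bot \<longleftrightarrow> False"
| "forces K k e (Rel p xs) \<longleftrightarrow> (p, map e xs) \<in> valuation K k"
| "forces K k e (And A B) \<longleftrightarrow> forces K k e A \<and> forces K k e B"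
| "forces K k e (Or A B) \<longleftrightarrow> forces K k e A \<or> forces K k e B"
| "forces K k e (Neg A) \<longleftrightarrow> (\<forall>k'. (k, k') \<in> order K \<longrightarrow> \<not> forces K k' e A)"
| "forces K k e (Imp A B) \<longleftrightarrow>
    (\<forall>k'. (k, k') \<in> order K \<longrightarrow> forces K k' e A \<longrightarrow> forces K k' e B)"
| "forces K k e (All x A) \<longleftrightarrow>
    (\<forall>k'. (k, k') \<in> order K \<longrightarrow> (\<forall>d \<in> domain K k'. forces K k' (e(x := d)) A))"
| "forces K k e (Ex x A) \<longleftrightarrow> (\<exists>d \<in> domain K k. forces K k (e(x := d)) A)"

definition forced_at :: "('p, 'k, 'd) kripke \<Rightarrow> 'k \<Rightarrow> 'p fm \<Rightarrow> bool" where
  "forced_at K k A \<longleftrightarrow> (\<forall>e. (\<forall>x \<in> fv A. e x \<in> domain K k) \<longrightarrow> forces K k e A)"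

text \<open>
  HOL cannot quantify over types inside a formula, so a hypothesis about ``all Kripke structures''
  has to speak of structures with nodes in a given type \<open>'k\<close> and elements in a given type
  \<open>'d\<close>. The main theorem is polymorphic in both types and asks only that they be infinite (over a
  finite type there are too few structures). It thus covers every universe of structures large
  enough to contain the countable ones.
\<close>

end

theory Submission
  imports Defs "HOL-Library.Countable_Set" "HOL-Library.Sublist"
begin

text \<open>
  This is Henkin's completeness argument for intuitionistic logic, in which neutralization
  makes the countermodel constrained of its own accord. If \<open>T\<close> is maximal among the sets that
  do not prove \<open>B\<close> and \<open>q\<close> is a propositional symbol, then \<open>q\<close> or \<open>\<not> q\<close> belongs to \<open>T\<close>:
  otherwise \<open>B\<close> would follow from \<open>T, q\<close> and from \<open>T, \<not> q\<close>, hence from \<open>T\<close> by neutralization.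
  A structure whose nodes are such sets, growing along the order, can therefore never start to
  force \<open>q\<close> above a node that does not force it: that node already contains \<open>\<not> q\<close>.

  Lemma \<open>saturation\<close> extends a set that does not prove \<open>B\<close> to a maximal one; such a set is
  closed under derivability, prime, and contains a witness for each of its existential formulas.
  There may be uncountably many saturated sets, whereas the type of nodes is only known
  to be infinite. So the nodes form instead the tree of finite sequences of requests (lemma
  \<open>child_exists\<close>): a request is a pair of formulas \<open>A, B\<close>, and the corresponding
  child of a node contains \<open>A\<close> but not \<open>B\<close> whenever this is consistent with the set at the node.
  These are the extensions that refute implications, negations and universal formulas not in the
  set, and this gives the equivalence of forcing and membership (lemma \<open>truth\<close>). Only the symbols
  of the given formula are used, so that there are countably many formulas and requests, even
  though the language itself may be uncountable.

  Elements of the domains are variables, and domains must grow: refuting a universal formula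
  needs a variable that is new to the whole infinite set at the node. Therefore the
  variables above a bound \<open>m\<close> are split into infinitely many infinite layers, and a node at
  depth \<open>n\<close> uses the layers up to \<open>n\<close>. Variables below \<open>m\<close> occur only bound, so that
  substituting an element never leads to capture and bound variables are never renamed.

  This treats closed formulas. An open formula is reduced to its universal closure, since
  \<open>\<forall>x F\<close> is forced everywhere if \<open>F\<close> is, and conversely \<open>F\<close> is derivable from \<open>\<forall>x F\<close>.
\<close>

section \<open>Derivability from sets of formulas\<close>

lemma LJ_plus_formulas:
  assumes "LJ_plus L \<Gamma> (Some B)"
  shows "\<forall>A \<in> set \<Gamma>. formula L A" "formula L B"
  using LJ_plus_formula[OF assms] by auto

lemma LJ_plus_to_front: "LJ_plus L (xs @ A # ys) \<Lambda> \<Longrightarrow> LJ_plus L (A # xs @ ys) \<Lambda>"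
proof (induction xs arbitrary: ys rule: rev_induct)
  case Nil
  then show ?case by simp
next
  case (snoc b xs)
  then have "LJ_plus L (xs @ b # A # ys) \<Lambda>" by simp
  then have "LJ_plus L (xs @ A # b # ys) \<Lambda>" by (rule Exch)
  from snoc.IH[OF this] show ?case by simp
qed

lemma LJ_plus_shift: "LJ_plus L (zs @ A # xs @ ys) \<Lambda> \<Longrightarrow> LJ_plus L (zs @ xs @ A # ys) \<Lambda>"
proof (induction xs arbitrary: zs)
  case Nil
  then show ?case by simp
next
  case (Cons b xs)
  then have "LJ_plus L (zs @ A # b # (xs @ ys)) \<Lambda>" by simp
  then have "LJ_plus L (zs @ b # A # (xs @ ys)) \<Lambda>" by (rule Exch)
  then have "LJ_plus L ((zs @ [b]) @ A # xs @ ys) \<Lambda>" by simp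
  from Cons.IH[OF this] show ?case by simp
qed

lemma LJ_plus_swap: "LJ_plus L (xs @ ys) \<Lambda> \<Longrightarrow> LJ_plus L (ys @ xs) \<Lambda>"
proof (induction xs arbitrary: ys)
  case Nil
  then show ?case by simp
next
  case (Cons a xs)
  have "LJ_plus L ([] @ (xs @ ys) @ a # []) \<Lambda>"
    by (rule LJ_plus_shift) (use Cons.prems in simp)
  then have "LJ_plus L (xs @ (ys @ [a])) \<Lambda>" by simp
  from Cons.IH[OF this] show ?case by simp
qed

lemma LJ_plus_absorb:
  assumes "LJ_plus L (A # \<Gamma>) \<Lambda>" and "A \<in> set \<Gamma>"
  shows "LJ_plus L \<Gamma> \<Lambda>"
proof -
  obtain xs ys where \<Gamma>: "\<Gamma> = xs @ A # ys" using assms(2) by (meson split_list)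
  have "LJ_plus L ((A # xs) @ A # ys) \<Lambda>" using assms(1) \<Gamma> by simp
  then have "LJ_plus L (A # A # xs @ ys) \<Lambda>" by (drule_tac LJ_plus_to_front) simp
  then have "LJ_plus L ([] @ A # xs @ ys) \<Lambda>" by (simp add: Contr)
  then have "LJ_plus L ([] @ xs @ A # ys) \<Lambda>" by (rule LJ_plus_shift)
  then show ?thesis using \<Gamma> by simp
qed

text \<open>
  The three structural rules together: an antecedent matters only as a set, and may grow.
\<close>

lemma LJ_plus_weaken:
  assumes "LJ_plus L \<Gamma> \<Lambda>" and "set \<Gamma> \<subseteq> set \<Gamma>'" and "\<forall>A \<in> set \<Gamma>'. formula L A"
  shows "LJ_plus L \<Gamma>' \<Lambda>"
proof -
  have "LJ_plus L (\<Gamma>' @ \<Gamma>) \<Lambda>"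
    using assms(3) by (induction \<Gamma>') (auto intro: ThinL assms(1))
  then have "LJ_plus L (\<Gamma> @ \<Gamma>') \<Lambda>" by (rule LJ_plus_swap)
  then show ?thesis using assms(2)
  proof (induction \<Gamma>)
    case (Cons A \<Gamma>)
    have "LJ_plus L (\<Gamma> @ \<Gamma>') \<Lambda>"
      by (rule LJ_plus_absorb[of L A]) (use Cons.prems in auto)
    then show ?case using Cons by simp
  qed simp
qed

definition prv :: "'p lang \<Rightarrow> 'p fm set \<Rightarrow> 'p fm \<Rightarrow> bool" where
  "prv L T B \<longleftrightarrow> (\<exists>\<Gamma>. set \<Gamma> \<subseteq> T \<and> LJ_plus L \<Gamma> (Some B))"

lemma prv_mono: "prv L T B \<Longrightarrow> T \<subseteq> T' \<Longrightarrow> prv L T' B"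
  unfolding prv_def by blast

lemma prv_Ax: "A \<in> T \<Longrightarrow> formula L A \<Longrightarrow> prv L T A"
  unfolding prv_def by (rule exI[of _ "[A]"]) (auto intro: LJ_plus.Ax)

lemma prv_formula: "prv L T B \<Longrightarrow> formula L B"
  unfolding prv_def using LJ_plus_formulas(2) by blast

text \<open>
  The left rules act on one occurrence of a formula, while a derivation from a set may use it any
  number of times or not at all; weakening brings it into the form that those rules expect.
\<close>

lemma prv_insertE:
  assumes "prv L (insert A T) B" and "formula L A"
  obtains \<Gamma> where "set \<Gamma> \<subseteq> T" and "LJ_plus L (A # \<Gamma>) (Some B)"
proof -
  obtain \<Delta> where \<Delta>: "set \<Delta> \<subseteq> insert A T" "LJ_plus L \<Delta> (Some B)"
    using assms(1) unfolding prv_def by blast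
  let ?\<Gamma> = "filter (\<lambda>C. C \<noteq> A) \<Delta>"
  have "LJ_plus L (A # ?\<Gamma>) (Some B)"
    by (rule LJ_plus_weaken[OF \<Delta>(2)]) (use LJ_plus_formulas(1)[OF \<Delta>(2)] assms(2) in auto)
  moreover have "set ?\<Gamma> \<subseteq> T" using \<Delta>(1) by auto
  ultimately show thesis using that by blast
qed

lemma prv_cut:
  assumes "prv L T C" and "prv L (insert C T) B"
  shows "prv L T B"
proof -
  obtain \<Gamma> where \<Gamma>: "set \<Gamma> \<subseteq> T" "LJ_plus L \<Gamma> (Some C)" using assms(1) unfolding prv_def by blast
  obtain \<Pi> where \<Pi>: "set \<Pi> \<subseteq> T" "LJ_plus L (C # \<Pi>) (Some B)"
    using prv_insertE[OF assms(2) prv_formula[OF assms(1)]] .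
  have "LJ_plus L (\<Gamma> @ \<Pi>) (Some B)" using \<Gamma>(2) \<Pi>(2) by (rule Cut)
  then show ?thesis unfolding prv_def using \<Gamma>(1) \<Pi>(1) by (metis le_sup_iff set_append)
qed

lemma prv_by:
  assumes "LJ_plus L [C] (Some B)" and "prv L T C"
  shows "prv L T B"
  by (rule prv_cut[OF assms(2)]) (use assms(1) in \<open>auto simp: prv_def intro!: exI[of _ "[C]"]\<close>)

text \<open>
  The rules with two premises ask for the same side formulas in both. Here \<open>\<Phi>\<close> and \<open>\<Psi>\<close> hold the
  active formulas.
\<close>

lemma prv_common:
  assumes "set \<Gamma> \<subseteq> T" "LJ_plus L (\<Phi> @ \<Gamma>) \<Lambda>" "set \<Delta> \<subseteq> T" "LJ_plus L (\<Psi> @ \<Delta>) \<Lambda>'"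
  obtains \<Theta> where "set \<Theta> \<subseteq> T" "LJ_plus L (\<Phi> @ \<Theta>) \<Lambda>" "LJ_plus L (\<Psi> @ \<Theta>) \<Lambda>'"
proof (rule that[of "\<Gamma> @ \<Delta>"])
  note f = LJ_plus_formula[OF assms(2)] LJ_plus_formula[OF assms(4)]
  show "set (\<Gamma> @ \<Delta>) \<subseteq> T" using assms by simp
  show "LJ_plus L (\<Phi> @ \<Gamma> @ \<Delta>) \<Lambda>" by (rule LJ_plus_weaken[OF assms(2)]) (use f in auto)
  show "LJ_plus L (\<Psi> @ \<Gamma> @ \<Delta>) \<Lambda>'" by (rule LJ_plus_weaken[OF assms(4)]) (use f in auto)
qed

lemma prv_Top: "prv L T Top"
  unfolding prv_def by (rule exI[of _ "[]"]) (simp add: TopAx)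

lemma prv_BotE:
  assumes "prv L T Bot" and "formula L B"
  shows "prv L T B"
  by (rule prv_by[OF ThinR[OF BotAx] assms(1)]) (rule assms(2))

lemma prv_AndI:
  assumes "prv L T A" and "prv L T B"
  shows "prv L T (And A B)"
proof -
  obtain \<Gamma> \<Delta> where \<Gamma>: "set \<Gamma> \<subseteq> T" "LJ_plus L ([] @ \<Gamma>) (Some A)"
    and \<Delta>: "set \<Delta> \<subseteq> T" "LJ_plus L ([] @ \<Delta>) (Some B)"
    using assms unfolding prv_def by auto
  obtain \<Theta> where "set \<Theta> \<subseteq> T" "LJ_plus L ([] @ \<Theta>) (Some A)" "LJ_plus L ([] @ \<Theta>) (Some B)"
    by (rule prv_common[OF \<Gamma> \<Delta>])
  then show ?thesis unfolding prv_def by (auto intro: AndR)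
qed

lemma prv_AndE:
  assumes "prv L T (And A B)"
  shows "prv L T A" "prv L T B"
proof -
  have f: "formula L A" "formula L B" using prv_formula[OF assms] by auto
  show "prv L T A" by (rule prv_by[OF AndL1[OF Ax] assms]) (rule f)+
  show "prv L T B" by (rule prv_by[OF AndL2[OF Ax] assms]) (rule f)+
qed

lemma prv_OrI1: "prv L T A \<Longrightarrow> formula L B \<Longrightarrow> prv L T (Or A B)"
  unfolding prv_def by (blast intro: OrR1)

lemma prv_OrI2: "prv L T B \<Longrightarrow> formula L A \<Longrightarrow> prv L T (Or A B)"
  unfolding prv_def by (blast intro: OrR2)

lemma prv_OrE:
  assumes "prv L T (Or A B)" and "prv L (insert A T) C" and "prv L (insert B T) C"
  shows "prv L T C"
proof -
  have f: "formula L A" "formula L B" using prv_formula[OF assms(1)] by auto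
  obtain \<Gamma> where \<Gamma>: "set \<Gamma> \<subseteq> T" "LJ_plus L ([A] @ \<Gamma>) (Some C)"
    using prv_insertE[OF assms(2) f(1)] by auto
  obtain \<Delta> where \<Delta>: "set \<Delta> \<subseteq> T" "LJ_plus L ([B] @ \<Delta>) (Some C)"
    using prv_insertE[OF assms(3) f(2)] by auto
  obtain \<Theta> where \<Theta>: "set \<Theta> \<subseteq> T" "LJ_plus L ([A] @ \<Theta>) (Some C)" "LJ_plus L ([B] @ \<Theta>) (Some C)"
    by (rule prv_common[OF \<Gamma> \<Delta>])
  have "LJ_plus L (Or A B # \<Theta>) (Some C)" using \<Theta>(2,3) by (auto intro: OrL)
  then have "prv L (insert (Or A B) T) C"
    unfolding prv_def using \<Theta>(1) by (intro exI[of _ "Or A B # \<Theta>"]) auto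
  then show ?thesis by (rule prv_cut[OF assms(1)])
qed

lemma prv_neutral:
  assumes "prv L (insert N T) B" and "prv L (insert (Neg N) T) B" and "propositional L N"
  shows "prv L T B"
proof -
  have f: "formula L N" "formula L (Neg N)" using assms(3) by (auto simp: propositional_def)
  obtain \<Gamma> where \<Gamma>: "set \<Gamma> \<subseteq> T" "LJ_plus L ([N] @ \<Gamma>) (Some B)"
    using prv_insertE[OF assms(1) f(1)] by auto
  obtain \<Delta> where \<Delta>: "set \<Delta> \<subseteq> T" "LJ_plus L ([Neg N] @ \<Delta>) (Some B)"
    using prv_insertE[OF assms(2) f(2)] by auto
  obtain \<Theta> where \<Theta>: "set \<Theta> \<subseteq> T"
    "LJ_plus L ([N] @ \<Theta>) (Some B)" "LJ_plus L ([Neg N] @ \<Theta>) (Some B)"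
    by (rule prv_common[OF \<Gamma> \<Delta>])
  have "LJ_plus L \<Theta> (Some B)" by (rule Neutral[OF _ _ assms(3)]) (use \<Theta>(2,3) in simp_all)
  then show ?thesis unfolding prv_def using \<Theta>(1) by blast
qed

lemma prv_ImpI:
  assumes "prv L (insert A T) B" and "formula L A"
  shows "prv L T (Imp A B)"
proof -
  obtain \<Gamma> where "set \<Gamma> \<subseteq> T" "LJ_plus L (A # \<Gamma>) (Some B)" by (rule prv_insertE[OF assms])
  then show ?thesis unfolding prv_def by (auto intro: ImpR)
qed

lemma prv_ImpE:
  assumes "prv L T (Imp A B)" and "prv L T A"
  shows "prv L T B"
proof -
  have f: "formula L A" "formula L B" using prv_formula[OF assms(1)] by auto
  have "LJ_plus L (Imp A B # [A] @ []) (Some B)" by (rule ImpL[OF Ax Ax]) (rule f)+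
  then have "prv L (insert A (insert (Imp A B) T)) B"
    unfolding prv_def by (intro exI[of _ "[Imp A B, A]"]) auto
  then have "prv L (insert (Imp A B) T) B"
    by (rule prv_cut[OF prv_mono[OF assms(2)], rotated]) auto
  then show ?thesis by (rule prv_cut[OF assms(1)])
qed

lemma prv_NegI:
  assumes "prv L (insert A T) Bot" and "formula L A"
  shows "prv L T (Neg A)"
proof -
  obtain \<Gamma> where \<Gamma>: "set \<Gamma> \<subseteq> T" "LJ_plus L (A # \<Gamma>) (Some Bot)" by (rule prv_insertE[OF assms])
  have "LJ_plus L (A # \<Gamma>) None" using Cut[OF \<Gamma>(2) BotAx] by simp
  then show ?thesis unfolding prv_def using \<Gamma>(1) by (auto intro: NegR)
qed

lemma prv_NegE:
  assumes "prv L T (Neg A)" and "prv L T A"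
  shows "prv L T Bot"
proof -
  have f: "formula L A" using prv_formula[OF assms(2)] .
  have "LJ_plus L [Neg A, A] (Some Bot)" by (rule ThinR[OF NegL[OF Ax]]) (simp_all add: f)
  then have "prv L (insert A (insert (Neg A) T)) Bot"
    unfolding prv_def by (intro exI[of _ "[Neg A, A]"]) auto
  then have "prv L (insert (Neg A) T) Bot"
    by (rule prv_cut[OF prv_mono[OF assms(2)], rotated]) auto
  then show ?thesis by (rule prv_cut[OF assms(1)])
qed

lemma prv_AllI:
  assumes "prv L T (subst x a A)" and "free_for a x A" and "formula L (All x A)"
    and "a \<notin> vars (All x A)" and "\<forall>G\<in>T. a \<notin> vars G"
  shows "prv L T (All x A)"
proof -
  obtain \<Gamma> where \<Gamma>: "set \<Gamma> \<subseteq> T" "LJ_plus L \<Gamma> (Some (subst x a A))"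
    using assms(1) unfolding prv_def by blast
  have "LJ_plus L \<Gamma> (Some (All x A))"
    by (rule AllR[OF \<Gamma>(2) assms(2-4)]) (use \<Gamma>(1) assms(5) in blast)
  then show ?thesis unfolding prv_def using \<Gamma>(1) by blast
qed

lemma prv_AllE:
  assumes "prv L T (All x A)" and "free_for a x A" and "formula L (subst x a A)"
  shows "prv L T (subst x a A)"
  by (rule prv_by[OF AllL[OF Ax] assms(1)])
    (use assms prv_formula[OF assms(1)] in auto)

lemma prv_ExI:
  assumes "prv L T (subst x a A)" and "free_for a x A" and "formula L (Ex x A)"
  shows "prv L T (Ex x A)"
  using assms unfolding prv_def by (blast intro: ExR)

lemma prv_ExE:
  assumes "prv L (insert (subst x a A) T) C" and "free_for a x A" and "formula L (subst x a A)"
    and "formula L (Ex x A)" and "a \<notin> vars (Ex x A)" and "\<forall>G\<in>insert C T. a \<notin> vars G"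
  shows "prv L (insert (Ex x A) T) C"
proof -
  obtain \<Gamma> where \<Gamma>: "set \<Gamma> \<subseteq> T" "LJ_plus L (subst x a A # \<Gamma>) (Some C)"
    by (rule prv_insertE[OF assms(1,3)])
  have "LJ_plus L (Ex x A # \<Gamma>) (Some C)"
    by (rule ExL[OF \<Gamma>(2) assms(2,4,5)]) (use \<Gamma>(1) assms(6) in auto)
  then show ?thesis unfolding prv_def using \<Gamma>(1) by (intro exI[of _ "Ex x A # \<Gamma>"]) auto
qed


section \<open>Bound variables and instances\<close>

primrec bv :: "'p fm \<Rightarrow> var set" where
  "bv Top = {}"
| "bv Bot = {}"
| "bv (Rel p xs) = {}"
| "bv (And A B) = bv A \<union> bv B"
| "bv (Or A B) = bv A \<union> bv B"
| "bv (Neg A) = bv A"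
| "bv (Imp A B) = bv A \<union> bv B"
| "bv (All x A) = insert x (bv A)"
| "bv (Ex x A) = insert x (bv A)"

lemma vars_fv_bv: "vars A = fv A \<union> bv A"
  by (induction A) auto

lemma finite_vars: "finite (vars A)"
  by (induction A) auto

lemma free_for_bv: "a \<notin> bv A \<Longrightarrow> free_for a x A"
  by (induction A) auto

lemma bv_subst [simp]: "bv (subst x a A) = bv A"
  by (induction A) auto

lemma syms_subst [simp]: "syms (subst x a A) = syms A"
  by (induction A) auto

lemma fv_subst: "fv (subst x a A) \<subseteq> insert a (fv A - {x})"
  by (induction A) auto

lemma fv_subst_other: "y \<in> fv A \<Longrightarrow> y \<noteq> x \<Longrightarrow> y \<in> fv (subst x a A)"
  by (induction A) auto

lemma formula_subst: "formula L A \<Longrightarrow> formula L (subst x a A)"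
  by (induction A) (auto simp: fv_subst_other)

text \<open>
  Simultaneous replacement of the free variables, without renaming. In the truth lemma \<open>e\<close>
  sends the free variables to elements of a domain, which never occur bound.
\<close>

primrec inst :: "(var \<Rightarrow> var) \<Rightarrow> 'p fm \<Rightarrow> 'p fm" where
  "inst e Top = Top"
| "inst e Bot = Bot"
| "inst e (Rel p xs) = Rel p (map e xs)"
| "inst e (And A B) = And (inst e A) (inst e B)"
| "inst e (Or A B) = Or (inst e A) (inst e B)"
| "inst e (Neg A) = Neg (inst e A)"
| "inst e (Imp A B) = Imp (inst e A) (inst e B)"
| "inst e (All x A) = All x (inst (e(x := x)) A)"
| "inst e (Ex x A) = Ex x (inst (e(x := x)) A)"

lemma bv_inst [simp]: "bv (inst e A) = bv A"
  by (induction A arbitrary: e) auto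

lemma syms_inst [simp]: "syms (inst e A) = syms A"
  by (induction A arbitrary: e) auto

lemma inst_cong: "(\<And>y. y \<in> fv A \<Longrightarrow> e y = e' y) \<Longrightarrow> inst e A = inst e' A"
proof (induction A arbitrary: e e')
  case (And A B)
  show ?case using And.prems by (auto intro!: And.IH)
next
  case (Or A B)
  show ?case using Or.prems by (auto intro!: Or.IH)
next
  case (Neg A)
  show ?case using Neg.prems by (auto intro!: Neg.IH)
next
  case (Imp A B)
  show ?case using Imp.prems by (auto intro!: Imp.IH)
next
  case (All x A)
  show ?case using All.prems by (auto intro!: All.IH)
next
  case (Ex x A)
  show ?case using Ex.prems by (auto intro!: Ex.IH)
qed auto

lemma inst_id: "inst (\<lambda>y. y) A = A"
  by (induction A) (simp_all add: fun_upd_idem)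

text \<open>
  The disjunct \<open>e y = y\<close> is what survives under a quantifier, where \<open>inst\<close> leaves the bound
  variable fixed.
\<close>

definition no_capture :: "(var \<Rightarrow> var) \<Rightarrow> 'p fm \<Rightarrow> bool" where
  "no_capture e A \<longleftrightarrow> (\<forall>y \<in> fv A. e y = y \<or> e y \<notin> bv A)"

lemma no_captureD:
  "no_capture e (And A B) \<Longrightarrow> no_capture e A \<and> no_capture e B"
  "no_capture e (Or A B) \<Longrightarrow> no_capture e A \<and> no_capture e B"
  "no_capture e (Imp A B) \<Longrightarrow> no_capture e A \<and> no_capture e B"
  "no_capture e (Neg A) \<Longrightarrow> no_capture e A"
  "no_capture e (All x A) \<Longrightarrow> no_capture (e(x := x)) A"
  "no_capture e (Ex x A) \<Longrightarrow> no_capture (e(x := x)) A"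
  by (auto simp: no_capture_def)

lemma no_capture_neq:
  assumes "no_capture e (All x A)" and "y \<in> fv A" and "y \<noteq> x"
  shows "e y \<noteq> x"
proof -
  have "e y = y \<or> e y \<notin> bv (All x A)" using assms unfolding no_capture_def by fastforce
  then show ?thesis using assms(3) by auto
qed

lemma no_capture_Ex_All: "no_capture e (Ex x A) \<longleftrightarrow> no_capture e (All x A)"
  by (simp add: no_capture_def)

lemma fv_inst: "no_capture e A \<Longrightarrow> fv (inst e A) = e ` fv A"
proof (induction A arbitrary: e)
  case (All x A)
  have "fv (inst (e(x := x)) A) - {x} = (e(x := x)) ` fv A - {x}"
    by (simp only: All.IH[OF no_captureD(5)[OF All.prems]])
  also have "\<dots> = e ` (fv A - {x})"
    using no_capture_neq[OF All.prems] by force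
  finally show ?case by simp
next
  case (Ex x A)
  have "fv (inst (e(x := x)) A) - {x} = (e(x := x)) ` fv A - {x}"
    by (simp only: Ex.IH[OF no_captureD(6)[OF Ex.prems]])
  also have "\<dots> = e ` (fv A - {x})"
    using no_capture_neq[OF Ex.prems[unfolded no_capture_Ex_All]] by force
  finally show ?case by simp
qed (auto dest!: no_captureD)

lemma formula_inst: "no_capture e A \<Longrightarrow> formula L A \<Longrightarrow> formula L (inst e A)"
proof (induction A arbitrary: e)
  case (All x A)
  have nc: "no_capture (e(x := x)) A" by (rule no_captureD(5)[OF All.prems(1)])
  have "x \<in> (e(x := x)) ` fv A" using All.prems(2) by (intro rev_image_eqI[of x]) simp_all
  moreover have "formula L (inst (e(x := x)) A)" by (rule All.IH[OF nc]) (use All.prems(2) in simp)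
  ultimately show ?case by (simp del: fun_upd_apply add: fv_inst[OF nc])
next
  case (Ex x A)
  have nc: "no_capture (e(x := x)) A" by (rule no_captureD(6)[OF Ex.prems(1)])
  have "x \<in> (e(x := x)) ` fv A" using Ex.prems(2) by (intro rev_image_eqI[of x]) simp_all
  moreover have "formula L (inst (e(x := x)) A)" by (rule Ex.IH[OF nc]) (use Ex.prems(2) in simp)
  ultimately show ?case by (simp del: fun_upd_apply add: fv_inst[OF nc])
qed (auto dest!: no_captureD)

lemma subst_inst:
  "no_capture e A \<Longrightarrow> subst x d (inst e A) = inst (\<lambda>y. if e y = x then d else e y) A"
proof (induction A arbitrary: e)
  case (All z A)
  show ?case
  proof (cases "z = x")
    case True
    then show ?thesis using no_capture_neq[OF All.prems]
      by (auto intro!: inst_cong)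
  next
    case False
    have "subst x d (inst (e(z := z)) A) = inst ((\<lambda>y. if e y = x then d else e y)(z := z)) A"
      unfolding All.IH[OF no_captureD(5)[OF All.prems]] by (rule inst_cong) (use False in simp)
    then show ?thesis using False by simp
  qed
next
  case (Ex z A)
  show ?case
  proof (cases "z = x")
    case True
    then show ?thesis using no_capture_neq[OF Ex.prems[unfolded no_capture_Ex_All]]
      by (auto intro!: inst_cong)
  next
    case False
    have "subst x d (inst (e(z := z)) A) = inst ((\<lambda>y. if e y = x then d else e y)(z := z)) A"
      unfolding Ex.IH[OF no_captureD(6)[OF Ex.prems]] by (rule inst_cong) (use False in simp)
    then show ?thesis using False by simp
  qed
qed (auto dest!: no_captureD)

text \<open>
  This matches the syntactic instances of a quantified formula with the modified assignments in
  the forcing clauses for the quantifiers.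
\<close>

lemma subst_inst_upd:
  assumes "no_capture e (All x A)"
  shows "subst x d (inst (e(x := x)) A) = inst (e(x := d)) A"
  unfolding subst_inst[OF no_captureD(5)[OF assms]]
  by (rule inst_cong) (use no_capture_neq[OF assms] in auto)


section \<open>Saturated sets\<close>

instance fm :: (countable) countable
  by countable_datatype

lemma set_fm_syms: "set_fm A = syms A"
  by (induction A) auto

text \<open>
  The type of symbols may be uncountable, so the formulas are first renamed to formulas over the
  natural numbers.
\<close>

lemma countable_syms:
  assumes "countable S"
  shows "countable {A. syms A \<subseteq> S}"
proof -
  obtain f :: "'a \<Rightarrow> nat" where f: "inj_on f S" using assms by (auto simp: countable_def)
  have "inj_on (map_fm f) {A. syms A \<subseteq> S}"
  proof (rule inj_onI)
    fix A B assume "A \<in> {A. syms A \<subseteq> S}" "B \<in> {A. syms A \<subseteq> S}" "map_fm f A = map_fm f B"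
    then show "A = B"
      using f by (intro fm.inj_map_strong[of A B f f]) (auto simp: set_fm_syms inj_on_def)
  qed
  then show ?thesis by (rule countable_image_inj_on[rotated]) simp
qed

text \<open>
  \<open>S\<close> stands for the symbols of the formula to be refuted and \<open>m\<close> bounds its variables: those
  below \<open>m\<close> are reserved for binding, the others serve as elements of the domains.
\<close>

locale henkin =
  fixes L :: "'p lang" and S :: "'p set" and m :: nat and enum :: "nat \<Rightarrow> 'p fm"
  assumes enum: "{A. syms A \<subseteq> S} \<subseteq> range enum"
begin

definition frm :: "var set \<Rightarrow> 'p fm set" where
  "frm P = {A. formula L A \<and> syms A \<subseteq> S \<and> bv A \<subseteq> {..<m} \<and> fv A \<subseteq> P}"

lemma frm_mono: "P \<subseteq> P' \<Longrightarrow> frm P \<subseteq> frm P'"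
  by (auto simp: frm_def)

lemma frm_formula: "A \<in> frm P \<Longrightarrow> formula L A"
  by (simp add: frm_def)

lemma frm_enum:
  assumes "A \<in> frm P"
  obtains k where "A = enum k"
  using assms enum by (auto simp: frm_def)

lemma frm_subst:
  assumes "formula L A" "syms A \<subseteq> S" "bv A \<subseteq> {..<m}" "fv A - {x} \<subseteq> P" "d \<in> P"
  shows "subst x d A \<in> frm P"
  using assms fv_subst[of x d A] formula_subst[OF assms(1)] by (auto simp: frm_def)

text \<open>
  The last clause, that each propositional symbol is decided, is where the saturated sets of
  \<open>LJ\<^sup>+\<close> differ from those of intuitionistic logic.
\<close>

definition saturated :: "var set \<Rightarrow> 'p fm set \<Rightarrow> bool" where
  "saturated P T \<longleftrightarrow> T \<subseteq> frm P \<and> Bot \<notin> T \<and>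
    (\<forall>A \<in> frm P. prv L T A \<longrightarrow> A \<in> T) \<and>
    (\<forall>A B. Or A B \<in> T \<longrightarrow> A \<in> T \<or> B \<in> T) \<and>
    (\<forall>x A. Ex x A \<in> T \<longrightarrow> (\<exists>d \<in> P. subst x d A \<in> T)) \<and>
    (\<forall>q \<in> S. L q = Some 0 \<longrightarrow> Rel q [] \<in> T \<or> Neg (Rel q []) \<in> T)"

text \<open>
  Run once through all formulas, adding each one that does not lead to a proof of \<open>B\<close>, and with
  an existential formula also an instance by a variable that is still unused. Infinitely many
  unused variables remain after each of the finitely many additions made so far.
  In the limit every formula outside the set yields \<open>B\<close> when added, from which closure,
  primeness and, by neutralization, decidedness follow. One pass suffices for the witnesses: an
  existential formula in the limit did not lead to a proof of \<open>B\<close> at its own turn, so it received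
  a witness then.
\<close>

lemma saturation:
  assumes T: "T \<subseteq> frm P" and B: "B \<in> frm P" and P: "P \<subseteq> {m..}"
    and inf: "infinite (P - \<Union> (vars ` T))" and nB: "\<not> prv L T B"
  obtains T' where "T \<subseteq> T'" "saturated P T'" "B \<notin> T'"
proof -
  define I where "I X \<longleftrightarrow> T \<subseteq> X \<and> X \<subseteq> frm P \<and> infinite (P - \<Union> (vars ` X)) \<and> \<not> prv L X B" for X
  define R where "R k X Y \<longleftrightarrow> X \<subseteq> Y \<and> (enum k \<in> frm P \<longrightarrow> prv L (insert (enum k) X) B \<or>
      (enum k \<in> Y \<and> (\<forall>x A. enum k = Ex x A \<longrightarrow> (\<exists>d\<in>P. subst x d A \<in> Y))))" for k X Y
  \<comment> \<open>\<open>I\<close> is the invariant of the stages; \<open>R k\<close> says that stage \<open>k\<close> has dealt with its formula.\<close>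
  have drop: "infinite (P - \<Union> (vars ` insert C X))" if "infinite (P - \<Union> (vars ` X))" for C X
  proof -
    have "infinite ((P - \<Union> (vars ` X)) - vars C)"
      using that finite_vars[of C] by (metis Diff_infinite_finite)
    moreover have "(P - \<Union> (vars ` X)) - vars C = P - \<Union> (vars ` insert C X)" by auto
    ultimately show ?thesis by simp
  qed
  have step: "\<exists>Y. I Y \<and> R k X Y" if X: "I X" for X k
  proof (cases "enum k \<in> frm P \<and> \<not> prv L (insert (enum k) X) B")
    case False
    then show ?thesis using X by (intro exI[of _ X]) (auto simp: R_def)
  next
    case True
    let ?C = "enum k"
    have inf': "infinite (P - \<Union> (vars ` insert ?C X))"
      by (rule drop) (use X in \<open>auto simp: I_def\<close>)
    show ?thesis
    proof (cases "\<exists>x A. ?C = Ex x A")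
      case False
      then show ?thesis using X True inf' by (intro exI[of _ "insert ?C X"]) (auto simp: I_def R_def)
    next
      case ex: True
      then obtain x A where C: "?C = Ex x A" by blast
      have "infinite (P - \<Union> (vars ` insert B (insert ?C X)))" by (rule drop[OF inf'])
      then obtain d where "d \<in> P - \<Union> (vars ` insert B (insert ?C X))"
        using infinite_imp_nonempty by blast
      then have d: "d \<in> P" "d \<notin> vars ?C" "\<forall>G\<in>insert B X. d \<notin> vars G" by auto
      have A: "formula L A" "syms A \<subseteq> S" "bv A \<subseteq> {..<m}" "fv A - {x} \<subseteq> P"
        using True C by (auto simp: frm_def)
      have sub: "subst x d A \<in> frm P" by (rule frm_subst[OF A d(1)])
      let ?Y = "insert (subst x d A) (insert ?C X)"
      have "\<not> prv L ?Y B"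
      proof
        assume "prv L ?Y B"
        then have "prv L (insert (Ex x A) (insert ?C X)) B"
        proof (rule prv_ExE)
          show "free_for d x A" using A(3) d(1) P by (intro free_for_bv) fastforce
          show "formula L (subst x d A)" using sub by (rule frm_formula)
          show "formula L (Ex x A)" using True C frm_formula by metis
          show "d \<notin> vars (Ex x A)" using d(2) C by simp
          show "\<forall>G\<in>insert B (insert ?C X). d \<notin> vars G" using d by auto
        qed
        then show False using True C by simp
      qed
      moreover have "infinite (P - \<Union> (vars ` ?Y))" by (rule drop[OF inf'])
      ultimately show ?thesis using X True sub d(1) C
        by (intro exI[of _ ?Y]) (auto simp: I_def R_def)
    qed
  qed
  have "\<exists>f. \<forall>n. I (f n) \<and> R n (f n) (f (Suc n))"
    by (rule dependent_nat_choice) (use T inf nB step in \<open>auto simp: I_def\<close>)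
  then obtain f where f: "\<And>n. I (f n)" "\<And>n. R n (f n) (f (Suc n))" by blast
  have mono: "f i \<subseteq> f j" if "i \<le> j" for i j
    by (rule lift_Suc_mono_le[of f, OF _ that]) (use f(2) in \<open>auto simp: R_def\<close>)
  define T' where "T' = (\<Union>n. f n)"
  have fT: "f n \<subseteq> T'" for n by (auto simp: T'_def)
  have T'frm: "T' \<subseteq> frm P" using f(1) by (auto simp: T'_def I_def)
  have nT': "\<not> prv L T' B"
  proof
    assume "prv L T' B"
    then obtain \<Gamma> where \<Gamma>: "set \<Gamma> \<subseteq> T'" "LJ_plus L \<Gamma> (Some B)" unfolding prv_def by blast
    have "\<exists>n. set \<Gamma> \<subseteq> f n" using \<Gamma>(1)
    proof (induction \<Gamma>)
      case (Cons A \<Gamma>)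
      then obtain i j where "set \<Gamma> \<subseteq> f i" "A \<in> f j" by (auto simp: T'_def)
      then have "set (A # \<Gamma>) \<subseteq> f (max i j)" using mono[of i "max i j"] mono[of j "max i j"] by auto
      then show ?case by blast
    qed simp
    then show False using f(1) \<Gamma>(2) unfolding I_def prv_def by blast
  qed
  \<comment> \<open>Apart from the witnesses, the properties below follow from maximality alone.\<close>
  have max: "C \<in> T'" if C: "C \<in> frm P" "\<not> prv L (insert C T') B" for C
  proof -
    obtain k where k: "C = enum k" using frm_enum[OF C(1)] .
    have "\<not> prv L (insert C (f k)) B"
      using C(2) prv_mono[of L "insert C (f k)" B "insert C T'"] fT[of k] by auto
    then show ?thesis using f(2)[of k] C(1) k fT[of "Suc k"] by (auto simp: R_def)
  qed
  have closed: "C \<in> T'" if "C \<in> frm P" "prv L T' C" for C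
    using max[OF that(1)] prv_cut[OF that(2)] nT' by blast
  have "saturated P T'"
    unfolding saturated_def
  proof (intro conjI allI impI ballI)
    show "T' \<subseteq> frm P" by (rule T'frm)
    show "Bot \<notin> T'"
    proof
      assume "Bot \<in> T'"
      then have "prv L T' Bot" by (rule prv_Ax) simp
      then show False using prv_BotE[OF _ frm_formula[OF B]] nT' by blast
    qed
    show "A \<in> T'" if "A \<in> frm P" "prv L T' A" for A using closed that .
    show "A \<in> T' \<or> A' \<in> T'" if or: "Or A A' \<in> T'" for A A'
    proof (rule ccontr)
      assume "\<not> (A \<in> T' \<or> A' \<in> T')"
      moreover have fr: "Or A A' \<in> frm P" using or T'frm by auto
      then have "A \<in> frm P" "A' \<in> frm P" by (auto simp: frm_def)
      ultimately have "prv L (insert A T') B" "prv L (insert A' T') B" using max by auto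
      then show False using prv_OrE[OF prv_Ax[OF or frm_formula[OF fr]]] nT' by blast
    qed
    show "\<exists>d\<in>P. subst x d A \<in> T'" if ex: "Ex x A \<in> T'" for x A
    proof -
      have fr: "Ex x A \<in> frm P" using ex T'frm by auto
      then obtain k where k: "Ex x A = enum k" using frm_enum by metis
      have "\<not> prv L (insert (Ex x A) (f k)) B"
        using nT' prv_mono[of L "insert (Ex x A) (f k)" B T'] fT[of k] ex by auto
      then show ?thesis using f(2)[of k] fr k fT[of "Suc k"] unfolding R_def by (metis subsetD)
    qed
    show "Rel q [] \<in> T' \<or> Neg (Rel q []) \<in> T'" if q: "q \<in> S" "L q = Some 0" for q
    proof (rule ccontr)
      assume "\<not> (Rel q [] \<in> T' \<or> Neg (Rel q []) \<in> T')"
      moreover have "Rel q [] \<in> frm P" "Neg (Rel q []) \<in> frm P" using q by (auto simp: frm_def)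
      ultimately have "prv L (insert (Rel q []) T') B" "prv L (insert (Neg (Rel q [])) T') B"
        using max by blast+
      then have "prv L T' B" by (rule prv_neutral) (use q in \<open>auto simp: propositional_def\<close>)
      then show False using nT' by simp
    qed
  qed
  moreover have "B \<notin> T'" using nT' prv_Ax[OF _ frm_formula[OF B]] by blast
  moreover have "T \<subseteq> T'" using f(1)[of 0] fT[of 0] by (auto simp: I_def)
  ultimately show thesis using that by blast
qed


section \<open>The tree of saturated sets\<close>

text \<open>
  The pairing function splits the variables from \<open>m\<close> on into infinitely many infinite layers. Those
  up to \<open>n\<close> are the elements of the domain at depth \<open>n\<close>.
\<close>

definition par :: "nat \<Rightarrow> var set" where
  "par n = {m + prod_encode (i, j) | i j. i \<le> n}"

lemma par_ge: "par n \<subseteq> {m..}"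
  by (auto simp: par_def)

lemma par_mono: "n \<le> n' \<Longrightarrow> par n \<subseteq> par n'"
  unfolding par_def by (blast intro: order_trans)

lemma infinite_rank: "infinite (range (\<lambda>j. m + prod_encode (i, j)))"
  by (rule range_inj_infinite) (auto simp: inj_def)

lemma infinite_par: "infinite (par n)"
  by (rule infinite_super[OF _ infinite_rank[of 0]]) (auto simp: par_def)

lemma infinite_par_diff: "infinite (par (Suc n) - par n)"
  by (rule infinite_super[OF _ infinite_rank[of "Suc n"]]) (auto simp: par_def)

text \<open>
  The formulas of a request may already contain variables of the next layer; a universal formula
  is refuted by an instance with such a variable.
\<close>

definition child :: "nat \<Rightarrow> 'p fm set \<Rightarrow> 'p fm \<Rightarrow> 'p fm \<Rightarrow> 'p fm set \<Rightarrow> bool" where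
  "child n T A B T' \<longleftrightarrow> T \<subseteq> T' \<and> saturated (par (Suc n)) T' \<and>
    (A \<in> frm (par (Suc n)) \<longrightarrow> B \<in> frm (par (Suc n)) \<longrightarrow> \<not> prv L (insert A T) B \<longrightarrow>
      A \<in> T' \<and> B \<notin> T')"

text \<open>
  A request that cannot be met is replaced by the trivial one, \<open>\<top>\<close> but not \<open>\<bottom>\<close>, which can
  always be met. Thus every sequence of requests is a node.
\<close>

lemma child_exists:
  assumes T: "saturated (par n) T"
  shows "\<exists>T'. child n T A B T'"
proof -
  have *: "\<exists>T'. insert A T \<subseteq> T' \<and> saturated (par (Suc n)) T' \<and> B \<notin> T'"
    if A: "A \<in> frm (par (Suc n))" and B: "B \<in> frm (par (Suc n))" and n: "\<not> prv L (insert A T) B"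
    for A B
  proof (rule saturation[OF _ B par_ge _ n])
    have Tn: "T \<subseteq> frm (par n)" using T by (simp add: saturated_def)
    then show "insert A T \<subseteq> frm (par (Suc n))" using A frm_mono[OF par_mono[of n "Suc n"]] by auto
    have "\<Union> (vars ` T) \<subseteq> {..<m} \<union> par n"
      using Tn by (fastforce simp: frm_def vars_fv_bv)
    moreover have "par (Suc n) \<inter> {..<m} = {}" using par_ge[of "Suc n"] by fastforce
    ultimately have "(par (Suc n) - par n) - vars A \<subseteq> par (Suc n) - \<Union> (vars ` insert A T)"
      by blast
    then show "infinite (par (Suc n) - \<Union> (vars ` insert A T))"
      by (rule infinite_super) (metis Diff_infinite_finite infinite_par_diff finite_vars)
  qed blast
  show ?thesis
  proof (cases "A \<in> frm (par (Suc n)) \<and> B \<in> frm (par (Suc n)) \<and> \<not> prv L (insert A T) B")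
    case True
    then show ?thesis using *[of A B] by (auto simp: child_def)
  next
    case False
    have "\<not> prv L (insert Top T) Bot"
    proof
      assume "prv L (insert Top T) Bot"
      then have "prv L T Bot" by (rule prv_cut[OF prv_Top])
      then show False using T by (auto simp: saturated_def frm_def)
    qed
    then obtain T' where "insert Top T \<subseteq> T'" "saturated (par (Suc n)) T'"
      using *[of Top Bot] by (auto simp: frm_def)
    then show ?thesis using False by (auto simp: child_def)
  qed
qed

text \<open>
  The most recent request comes first in the list, so that the tree order is the suffix order and
  the depth is the length. Requests are pairs of indices into the enumeration.
\<close>

primrec Th :: "'p fm set \<Rightarrow> (nat \<times> nat) list \<Rightarrow> 'p fm set" where
  "Th T0 [] = T0"
| "Th T0 (c # p) = (SOME T'. child (length p) (Th T0 p) (enum (fst c)) (enum (snd c)) T')"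

context
  fixes T0 assumes T0: "saturated (par 0) T0"
begin

lemma Th_saturated: "saturated (par (length p)) (Th T0 p)"
  and Th_child: "child (length p) (Th T0 p) (enum (fst c)) (enum (snd c)) (Th T0 (c # p))"
proof -
  show *: "saturated (par (length p)) (Th T0 p)" for p
  proof (induction p)
    case (Cons c p)
    show ?case using someI_ex[OF child_exists[OF Cons]] by (simp add: child_def)
  qed (simp add: T0)
  show "child (length p) (Th T0 p) (enum (fst c)) (enum (snd c)) (Th T0 (c # p))"
    using someI_ex[OF child_exists[OF *]] by simp
qed

lemma Th_mono: "suffix p q \<Longrightarrow> Th T0 p \<subseteq> Th T0 q"
proof (induction q)
  case (Cons c q)
  then show ?case using Th_child[of q c] by (auto simp: suffix_Cons child_def simp del: Th.simps)
qed simp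

lemma Th_frm: "Th T0 p \<subseteq> frm (par (length p))"
  using Th_saturated by (simp add: saturated_def)

lemma Th_iff: "A \<in> frm (par (length p)) \<Longrightarrow> A \<in> Th T0 p \<longleftrightarrow> prv L (Th T0 p) A"
  using Th_saturated[of p] prv_Ax frm_formula unfolding saturated_def by blast

lemma Th_Bot: "Bot \<notin> Th T0 p"
  using Th_saturated by (simp add: saturated_def)

lemma Th_extension:
  assumes "A \<in> frm (par (Suc (length p)))" "B \<in> frm (par (Suc (length p)))"
    and "\<not> prv L (insert A (Th T0 p)) B"
  obtains q where "suffix p q" "length q = Suc (length p)" "A \<in> Th T0 q" "B \<notin> Th T0 q"
proof -
  obtain i j where "A = enum i" "B = enum j" using frm_enum assms(1,2) by metis
  then show thesis
    using Th_child[of p "(i, j)"] assms that[of "(i, j) # p"]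
    by (auto simp: child_def suffix_Cons simp del: Th.simps)
qed

lemma Th_Imp:
  assumes "Imp A B \<in> frm (par (length p))"
  shows "Imp A B \<in> Th T0 p \<longleftrightarrow> (\<forall>q. suffix p q \<longrightarrow> A \<in> Th T0 q \<longrightarrow> B \<in> Th T0 q)"
proof (intro iffI allI impI)
  fix q assume *: "Imp A B \<in> Th T0 p" "suffix p q" "A \<in> Th T0 q"
  then have I: "Imp A B \<in> Th T0 q" using Th_mono by blast
  then have fr: "Imp A B \<in> frm (par (length q))" using Th_frm by blast
  then have "A \<in> frm (par (length q))" "B \<in> frm (par (length q))" by (auto simp: frm_def)
  then show "B \<in> Th T0 q" using I *(3) Th_iff fr prv_ImpE by metis
next
  assume *: "\<forall>q. suffix p q \<longrightarrow> A \<in> Th T0 q \<longrightarrow> B \<in> Th T0 q"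
  have AB: "A \<in> frm (par (length p))" "B \<in> frm (par (length p))"
    using assms by (auto simp: frm_def)
  then have AB': "A \<in> frm (par (Suc (length p)))" "B \<in> frm (par (Suc (length p)))"
    using frm_mono[OF par_mono[of "length p" "Suc (length p)"]] by auto
  have "prv L (insert A (Th T0 p)) B"
    by (rule ccontr) (use Th_extension[OF AB'] * in blast)
  then show "Imp A B \<in> Th T0 p" using Th_iff[OF assms] prv_ImpI frm_formula AB by blast
qed

lemma Th_Neg:
  assumes "Neg A \<in> frm (par (length p))"
  shows "Neg A \<in> Th T0 p \<longleftrightarrow> (\<forall>q. suffix p q \<longrightarrow> A \<notin> Th T0 q)"
proof (intro iffI allI impI notI)
  fix q assume *: "Neg A \<in> Th T0 p" "suffix p q" "A \<in> Th T0 q"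
  then have I: "Neg A \<in> Th T0 q" using Th_mono by blast
  then have fr: "Neg A \<in> frm (par (length q))" using Th_frm by blast
  then have "A \<in> frm (par (length q))" by (auto simp: frm_def)
  then have "prv L (Th T0 q) Bot" using I *(3) Th_iff fr prv_NegE by metis
  then show False using Th_iff[of Bot q] Th_Bot by (auto simp: frm_def)
next
  assume *: "\<forall>q. suffix p q \<longrightarrow> A \<notin> Th T0 q"
  have A: "A \<in> frm (par (length p))" using assms by (auto simp: frm_def)
  then have A': "A \<in> frm (par (Suc (length p)))" "Bot \<in> frm (par (Suc (length p)))"
    using frm_mono[OF par_mono[of "length p" "Suc (length p)"]] by (auto simp: frm_def)
  have "prv L (insert A (Th T0 p)) Bot"
    by (rule ccontr) (use Th_extension[OF A'] * in blast)
  then show "Neg A \<in> Th T0 p" using Th_iff[OF assms] prv_NegI frm_formula A by blast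
qed

text \<open>
  If an instance by a variable of the next layer were provable from the set at \<open>p\<close>, where this
  variable does not occur, then so would be the universal formula. Hence a child omits it.
\<close>

lemma Th_All:
  assumes "All x A \<in> frm (par (length p))"
  shows "All x A \<in> Th T0 p \<longleftrightarrow>
    (\<forall>q. suffix p q \<longrightarrow> (\<forall>d \<in> par (length q). subst x d A \<in> Th T0 q))"
proof (intro iffI allI impI ballI)
  fix q d assume *: "All x A \<in> Th T0 p" "suffix p q" "d \<in> par (length q)"
  then have I: "All x A \<in> Th T0 q" using Th_mono by blast
  then have fr: "All x A \<in> frm (par (length q))" using Th_frm by blast
  then have A: "formula L A" "syms A \<subseteq> S" "bv A \<subseteq> {..<m}" "fv A - {x} \<subseteq> par (length q)"
    by (auto simp: frm_def)
  have sub: "subst x d A \<in> frm (par (length q))" by (rule frm_subst[OF A *(3)])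
  have "free_for d x A" using A(3) *(3) par_ge by (intro free_for_bv) fastforce
  then have "prv L (Th T0 q) (subst x d A)"
    using I Th_iff[OF fr] frm_formula[OF sub] by (intro prv_AllE) auto
  then show "subst x d A \<in> Th T0 q" using Th_iff[OF sub] by blast
next
  assume *: "\<forall>q. suffix p q \<longrightarrow> (\<forall>d \<in> par (length q). subst x d A \<in> Th T0 q)"
  obtain d where d: "d \<in> par (Suc (length p))" "d \<notin> par (length p)"
    using infinite_par_diff[of "length p"] by (metis Diff_iff finite.emptyI ex_in_conv)
  have dm: "m \<le> d" using d(1) par_ge by auto
  have A: "formula L A" "syms A \<subseteq> S" "bv A \<subseteq> {..<m}" "fv A - {x} \<subseteq> par (length p)"
    using assms by (auto simp: frm_def)
  have fresh: "d \<notin> vars G" if "G \<in> frm (par (length p))" for G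
    using that d(2) dm by (auto simp: frm_def vars_fv_bv)
  have sub: "Top \<in> frm (par (Suc (length p)))" "subst x d A \<in> frm (par (Suc (length p)))"
    using frm_subst[OF A(1-3) _ d(1)] A(4) par_mono[of "length p" "Suc (length p)"]
    by (auto simp: frm_def)
  \<comment> \<open>Only omission is asked for here, so the first half of the request is \<open>\<top>\<close>.\<close>
  have "prv L (insert Top (Th T0 p)) (subst x d A)"
  proof (rule ccontr)
    assume "\<not> ?thesis"
    then show False using Th_extension[OF sub] * d(1) by metis
  qed
  then have "prv L (Th T0 p) (subst x d A)" by (rule prv_cut[OF prv_Top])
  then have "prv L (Th T0 p) (All x A)"
    using dm A(3) fresh[OF assms] fresh Th_frm frm_formula[OF assms]
    by (intro prv_AllI free_for_bv) auto
  then show "All x A \<in> Th T0 p" using Th_iff[OF assms] by blast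
qed

lemma Th_Ex:
  assumes "Ex x A \<in> frm (par (length p))"
  shows "Ex x A \<in> Th T0 p \<longleftrightarrow> (\<exists>d \<in> par (length p). subst x d A \<in> Th T0 p)"
proof
  show "\<exists>d \<in> par (length p). subst x d A \<in> Th T0 p" if "Ex x A \<in> Th T0 p"
    using that Th_saturated[of p] by (auto simp: saturated_def)
next
  assume "\<exists>d \<in> par (length p). subst x d A \<in> Th T0 p"
  then obtain d where d: "d \<in> par (length p)" "subst x d A \<in> Th T0 p" by blast
  have "bv A \<subseteq> {..<m}" using assms by (auto simp: frm_def)
  then have "free_for d x A" using d(1) par_ge by (intro free_for_bv) fastforce
  moreover have "prv L (Th T0 p) (subst x d A)"
    using d(2) Th_frm frm_formula prv_Ax by blast
  ultimately show "Ex x A \<in> Th T0 p"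
    using prv_ExI frm_formula[OF assms] Th_iff[OF assms] by blast
qed

lemma Th_And:
  assumes "And A B \<in> frm (par (length p))"
  shows "And A B \<in> Th T0 p \<longleftrightarrow> A \<in> Th T0 p \<and> B \<in> Th T0 p"
proof -
  have "A \<in> frm (par (length p))" "B \<in> frm (par (length p))" using assms by (auto simp: frm_def)
  then show ?thesis using Th_iff assms prv_AndI prv_AndE by metis
qed

lemma Th_Or:
  assumes "Or A B \<in> frm (par (length p))"
  shows "Or A B \<in> Th T0 p \<longleftrightarrow> A \<in> Th T0 p \<or> B \<in> Th T0 p"
proof -
  have "A \<in> frm (par (length p))" "B \<in> frm (par (length p))" using assms by (auto simp: frm_def)
  then have "A \<in> Th T0 p \<or> B \<in> Th T0 p \<Longrightarrow> Or A B \<in> Th T0 p"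
    using Th_iff assms prv_OrI1 prv_OrI2 frm_formula by metis
  then show ?thesis using Th_saturated[of p] by (auto simp: saturated_def)
qed


section \<open>The tree as a Kripke structure\<close>

context
  fixes f :: "(nat \<times> nat) list \<Rightarrow> 'k" and g :: "nat \<Rightarrow> 'd"
  assumes f: "inj f" and g: "inj g"
begin

text \<open>The injections carry the tree and its elements over to the given infinite types.\<close>

definition canonical :: "('p, 'k, 'd) kripke" where
  "canonical = \<lparr>nodes = range f, order = {(f p, f q) | p q. suffix p q},
    domain = (\<lambda>k. g ` par (length (inv f k))),
    valuation = (\<lambda>k. {(r, map g ds) | r ds. Rel r ds \<in> Th T0 (inv f k)})\<rparr>"

lemma canonical_simps [simp]:
  "nodes canonical = range f"
  "(f p, k) \<in> order canonical \<longleftrightarrow> (\<exists>q. k = f q \<and> suffix p q)"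
  "domain canonical (f p) = g ` par (length p)"
  "(r, map g ds) \<in> valuation canonical (f p) \<longleftrightarrow> Rel r ds \<in> Th T0 p"
  using f g by (auto simp: canonical_def inj_map_eq_map inj_eq)

lemma canonical_structure: "kripke_structure L canonical"
  unfolding kripke_structure_def
proof (intro conjI)
  show "partial_order_on (nodes canonical) (order canonical)"
    unfolding partial_order_on_def preorder_on_def
    using f by (auto simp: canonical_def refl_on_def trans_def antisym_def inj_eq
        dest: suffix_order.trans)
  show "\<forall>k\<in>nodes canonical. domain canonical k \<noteq> {}"
    using infinite_imp_nonempty[OF infinite_par] by (simp add: canonical_def)
  show "\<forall>k\<in>nodes canonical. valuation canonical k \<subseteq>
      {(p, ds). L p = Some (length ds) \<and> set ds \<subseteq> domain canonical k}"
  proof -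
    have "L r = Some (length ds) \<and> set ds \<subseteq> par (length p)" if "Rel r ds \<in> Th T0 p" for r ds p
      using that Th_frm[of p] by (force simp: frm_def)
    then show ?thesis by (fastforce simp: canonical_def)
  qed
  show "\<forall>(k, k')\<in>order canonical. domain canonical k \<subseteq> domain canonical k' \<and>
      valuation canonical k \<subseteq> valuation canonical k'"
    using f par_mono[OF suffix_length_le] Th_mono by (fastforce simp: canonical_def)
qed

text \<open>
  If \<open>q\<close> is absent from the set at a node, then \<open>\<not> q\<close> is in that set and keeps \<open>q\<close> out
  of all the sets above it. Symbols outside \<open>S\<close> are forced nowhere.
\<close>

lemma canonical_constrained: "constrained L canonical"
  unfolding constrained_def
proof (clarify)
  fix k k' q assume o: "(k, k') \<in> order canonical" and q: "L q = Some 0"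
  obtain p p' where p: "k = f p" "k' = f p'" "suffix p p'" using o by (auto simp: canonical_def)
  have "Rel q [] \<in> Th T0 p" if r: "Rel q [] \<in> Th T0 p'"
  proof (rule ccontr)
    assume n: "Rel q [] \<notin> Th T0 p"
    have "q \<in> S" using r Th_frm by (force simp: frm_def)
    then have "Neg (Rel q []) \<in> Th T0 p" using n q Th_saturated[of p] by (auto simp: saturated_def)
    then show False using Th_Neg[of "Rel q []" p] Th_frm p(3) r by blast
  qed
  then show "(q, []) \<in> valuation canonical k \<longleftrightarrow> (q, []) \<in> valuation canonical k'"
    using Th_mono[OF p(3)] canonical_simps(4)[of q "[]"] p by auto
qed

lemma truth:
  assumes "formula L A" "syms A \<subseteq> S" "bv A \<subseteq> {..<m}" "e ` fv A \<subseteq> par (length p)"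
  shows "forces canonical (f p) (g \<circ> e) A \<longleftrightarrow> inst e A \<in> Th T0 p"
proof -
  have nc: "no_capture e A" if "bv A \<subseteq> {..<m}" "e ` fv A \<subseteq> par n" for e n and A :: "'p fm"
    using that par_ge[of n] by (fastforce simp: no_capture_def)
  have fr: "inst e A \<in> frm (par n)"
    if "formula L A" "syms A \<subseteq> S" "bv A \<subseteq> {..<m}" "e ` fv A \<subseteq> par n" for e n and A :: "'p fm"
    using that nc[OF that(3,4)] by (auto simp: frm_def fv_inst formula_inst)
  have upd: "(g \<circ> e)(x := g d) = g \<circ> e(x := d)" for e x d by auto
  have ext: "e ` X \<subseteq> par (length q)" if "suffix p q" "e ` X \<subseteq> par (length p)" for p q e X
    using that par_mono[OF suffix_length_le] by blast
  show ?thesis using assms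
  proof (induction A arbitrary: e p)
    case Top
    show ?case using Th_iff[of Top p] prv_Top by (auto simp: frm_def)
  next
    case Bot
    show ?case using Th_Bot by simp
  next
    case (Rel r xs)
    show ?case using canonical_simps(4)[of r "map e xs" p] by (simp add: comp_def)
  next
    case (And A B)
    have "forces canonical (f p) (g \<circ> e) A \<longleftrightarrow> inst e A \<in> Th T0 p"
      by (rule And.IH(1)) (use And.prems in \<open>simp_all add: image_Un\<close>)
    moreover have "forces canonical (f p) (g \<circ> e) B \<longleftrightarrow> inst e B \<in> Th T0 p"
      by (rule And.IH(2)) (use And.prems in \<open>simp_all add: image_Un\<close>)
    ultimately show ?case using Th_And[of "inst e A" "inst e B" p] fr[OF And.prems]
      by (simp add: comp_def)
  next
    case (Or A B)
    have "forces canonical (f p) (g \<circ> e) A \<longleftrightarrow> inst e A \<in> Th T0 p"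
      by (rule Or.IH(1)) (use Or.prems in \<open>simp_all add: image_Un\<close>)
    moreover have "forces canonical (f p) (g \<circ> e) B \<longleftrightarrow> inst e B \<in> Th T0 p"
      by (rule Or.IH(2)) (use Or.prems in \<open>simp_all add: image_Un\<close>)
    ultimately show ?case using Th_Or[of "inst e A" "inst e B" p] fr[OF Or.prems]
      by (simp add: comp_def)
  next
    case (Neg A)
    have "forces canonical (f q) (g \<circ> e) A \<longleftrightarrow> inst e A \<in> Th T0 q" if "suffix p q" for q
      by (rule Neg.IH) (use Neg.prems ext[OF that] in simp_all)
    then show ?case using Th_Neg[of "inst e A" p] fr[OF Neg.prems]
      by (auto simp: comp_def)
  next
    case (Imp A B)
    have "forces canonical (f q) (g \<circ> e) A \<longleftrightarrow> inst e A \<in> Th T0 q" if "suffix p q" for q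
      by (rule Imp.IH(1)) (use Imp.prems ext[OF that Imp.prems(4)] in \<open>simp_all add: image_Un\<close>)
    moreover have "forces canonical (f q) (g \<circ> e) B \<longleftrightarrow> inst e B \<in> Th T0 q" if "suffix p q" for q
      by (rule Imp.IH(2)) (use Imp.prems ext[OF that Imp.prems(4)] in \<open>simp_all add: image_Un\<close>)
    ultimately show ?case using Th_Imp[of "inst e A" "inst e B" p] fr[OF Imp.prems]
      by (auto simp: comp_def)
  next
    case (All x A)
    have "forces canonical (f q) ((g \<circ> e)(x := g d)) A \<longleftrightarrow>
        subst x d (inst (e(x := x)) A) \<in> Th T0 q"
      if q: "suffix p q" "d \<in> par (length q)" for q d
    proof -
      have "e(x := d) ` fv A \<subseteq> par (length q)" using q(2) ext[OF q(1) All.prems(4)] by auto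
      then show ?thesis
        unfolding upd subst_inst_upd[OF nc[OF All.prems(3,4)]]
        by (intro All.IH) (use All.prems in simp_all)
    qed
    then show ?case
      using Th_All[of x "inst (e(x := x)) A" p] fr[OF All.prems]
      by (auto simp: comp_def)
  next
    case (Ex x A)
    have nc': "no_capture e (All x A)" using nc[OF Ex.prems(3,4)] by (simp add: no_capture_def)
    have "forces canonical (f p) ((g \<circ> e)(x := g d)) A \<longleftrightarrow>
        subst x d (inst (e(x := x)) A) \<in> Th T0 p"
      if "d \<in> par (length p)" for d
    proof -
      have "e(x := d) ` fv A \<subseteq> par (length p)" using that Ex.prems(4) by auto
      then show ?thesis
        unfolding upd subst_inst_upd[OF nc'] by (intro Ex.IH) (use Ex.prems in simp_all)
    qed
    then show ?case
      using Th_Ex[of x "inst (e(x := x)) A" p] fr[OF Ex.prems]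
      by (auto simp: comp_def)
  qed
qed

end

end

end


section \<open>Completeness\<close>

lemma countermodel:
  fixes L :: "'p lang" and F :: "'p fm"
  assumes k: "infinite (UNIV :: 'k set)" and d: "infinite (UNIV :: 'd set)"
    and F: "formula L F" "fv F = {}" and n: "\<not> derivable L F"
  shows "\<exists>(K :: ('p, 'k, 'd) kripke) k. kripke_structure L K \<and> constrained L K \<and>
    k \<in> nodes K \<and> \<not> forced_at K k F"
proof -
  have cS: "countable {A. syms A \<subseteq> syms F}"
    by (rule countable_syms) (induction F; simp add: countable_finite)
  obtain m where m: "vars F \<subseteq> {..<m}" using finite_vars[of F] finite_nat_iff_bounded by blast
  interpret henkin L "syms F" m "from_nat_into {A. syms A \<subseteq> syms F}"
    by unfold_locales (use subset_range_from_nat_into[OF cS] in simp)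
  have "F \<in> frm (par 0)" using F m by (auto simp: frm_def vars_fv_bv)
  moreover have "\<not> prv L {} F" using n by (simp add: prv_def derivable_def)
  ultimately obtain T0 where T0: "saturated (par 0) T0" "F \<notin> T0"
    using saturation[of "{}" "par 0" F] par_ge[of 0] infinite_par[of 0] by auto
  obtain f' :: "nat \<Rightarrow> 'k" where f': "inj f'" using k infinite_countable_subset by blast
  obtain g :: "nat \<Rightarrow> 'd" where g: "inj g" using d infinite_countable_subset by blast
  define f where "f = f' \<circ> (to_nat :: (nat \<times> nat) list \<Rightarrow> nat)"
  have f: "inj f" unfolding f_def using f' by (simp add: inj_compose)
  let ?K = "canonical T0 f g"
  have "\<not> forces ?K (f []) (g \<circ> (\<lambda>y. y)) F"
    using truth[OF T0(1) f g F(1), of "\<lambda>y. y" "[]"] F(2) m T0(2)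
    by (auto simp: inst_id vars_fv_bv)
  then have "\<not> forced_at ?K (f []) F" using F(2) by (auto simp: forced_at_def)
  moreover have "f [] \<in> nodes ?K" by (simp add: canonical_simps[OF T0(1) f g])
  ultimately show ?thesis
    using canonical_structure[OF T0(1) f g] canonical_constrained[OF T0(1) f g] by blast
qed

lemma subst_self: "subst x x A = A"
  by (induction A) (auto simp: map_idI)

lemma free_for_self: "free_for x x A"
  by (induction A) auto

text \<open>
  A variable is free for itself, so \<open>\<forall>x A \<turnstile> A\<close> needs no renaming, even if \<open>x\<close> also occurs bound
  in \<open>A\<close>.
\<close>

lemma derivable_All_inst:
  assumes "derivable L (All x A)"
  shows "derivable L A"
proof -
  have f: "formula L (All x A)" using assms LJ_plus_formulas(2) unfolding derivable_def by blast
  have "LJ_plus L [All x A] (Some A)"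
    using AllL[of L x x A "[]" "Some A"] f by (simp add: subst_self free_for_self Ax)
  from Cut[OF assms[unfolded derivable_def] this] show ?thesis by (simp add: derivable_def)
qed

lemma forced_All:
  assumes K: "kripke_structure L K" and F: "\<forall>k \<in> nodes K. forced_at K k F"
  shows "forced_at K k (All x F)"
  unfolding forced_at_def forces.simps
proof (intro allI impI ballI)
  fix e k' d
  assume e: "\<forall>y\<in>fv (All x F). e y \<in> domain K k" and o: "(k, k') \<in> order K" and d: "d \<in> domain K k'"
  have "k' \<in> nodes K" "domain K k \<subseteq> domain K k'"
    using K o unfolding kripke_structure_def partial_order_on_def preorder_on_def by fast+
  moreover from this have "\<forall>y\<in>fv F. (e(x := d)) y \<in> domain K k'" using e d by auto
  ultimately show "forces K k' (e(x := d)) F" using F unfolding forced_at_def by blast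
qed

text \<open>
  The induction closes the formula one free variable at a time; only free variables may be
  quantified.
\<close>

theorem mainTheorem13:
  fixes L :: "'p lang" and F :: "'p fm"
  assumes "infinite (UNIV :: 'k set)" and "infinite (UNIV :: 'd set)"
    and "formula L F"
    and "\<And>K :: ('p, 'k, 'd) kripke. kripke_structure L K \<Longrightarrow> constrained L K \<Longrightarrow>
      \<forall>k \<in> nodes K. forced_at K k F"
  shows "derivable L F"
  using assms(3,4)
proof (induction "card (fv F)" arbitrary: F)
  case 0
  have "finite (fv F)" using finite_vars[of F] by (simp add: vars_fv_bv)
  then have "fv F = {}" using 0 by simp
  then show ?case using countermodel[OF assms(1,2) 0(2)] 0(3) by blast
next
  case (Suc n)
  then obtain x where x: "x \<in> fv F" by (metis card.empty ex_in_conv nat.distinct(1))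
  have "derivable L (All x F)"
  proof (rule Suc.hyps(1))
    show "n = card (fv (All x F))" using Suc.hyps(2) x by simp
    show "formula L (All x F)" using x Suc.prems(1) by simp
    show "\<forall>k\<in>nodes K. forced_at K k (All x F)"
      if "kripke_structure L K" "constrained L K" for K :: "('p, 'k, 'd) kripke"
      using forced_All[OF that(1) Suc.prems(2)[OF that]] by blast
  qed
  then show ?case by (rule derivable_All_inst)
qed

end
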